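(* For every integer $m\ge 1$, there exist two non-isomorphic trees $T_m$ and $T_m'$ such that $\nu(T_m)=\nu(T_m')=5$, and $T_m$ and $T_m'$ share the same adjacency spectrum, $\operatorname{Spec}(T_m)=\operatorname{Spec}(T_m')$, and the same total-walk sequence, $W_k(T_m)=W_k(T_m')$ for all $k\ge 0$ (hence the same generalized spectrum, i.e. also $\operatorname{Spec}(\overline{T_m})=\operatorname{Spec}(\overline{T_m'})$).
   Context: All graphs are finite, simple and undirected. For a graph $G$, $A(G)$ is its adjacency matrix, $\operatorname{Spec}(G)$ is its adjacency spectrum (the multiset of eigenvalues of $A(G)$), $\overline G$ is its complement, $\nu(G)$ is its matching number, and $W_k(G)=\mathbf 1^{\mathsf T}A(G)^k\mathbf 1$ (with $\mathbf 1$ the all-one vector of length $|V(G)|$). The generalized spectrum of $G$ is the pair $(\operatorname{Spec}(G),\operatorname{Spec}(\overline G))$. *)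

theory Defs
  imports
    "Graph_Theory.Digraph_Component"
    "Graph_Theory.Pair_Digraph"
    "Graph_Theory.Digraph_Isomorphism"
    "Jordan_Normal_Form.Char_Poly"
    "HOL-Library.Disjoint_Sets"
    "HOL-Computational_Algebra.Polynomial"
    Complex_Main
begin

text \<open>
  A finite simple undirected graph is a \<open>pair_graph\<close> of Graph_Theory: a finite, loop-free,
  symmetric relation \<open>parcs G\<close> on a finite vertex set \<open>pverts G\<close>; the edge \<open>uv\<close> is represented by
  the two arcs \<open>(u,v)\<close> and \<open>(v,u)\<close>.
\<close>

text \<open>
  The library predicate \<open>tree\<close> is not the right one here: in a symmetric digraph the walk
  \<open>u, v, u\<close> along a single edge counts as a cycle. The cycles of the underlying simple graph are
  exactly the cycles of length at least 3. Since \<open>connected\<close> requires a vertex, trees are nonempty.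
\<close>

definition is_tree :: "'a pair_pre_digraph \<Rightarrow> bool" where
  "is_tree G \<longleftrightarrow> pair_graph G \<and> connected (with_proj G) \<and>
     \<not> (\<exists>p. pre_digraph.cycle (with_proj G) p \<and> 3 \<le> length p)"

definition complement_graph :: "'a pair_pre_digraph \<Rightarrow> 'a pair_pre_digraph" where
  "complement_graph G = \<lparr> pverts = pverts G,
     parcs = {(u, v). u \<in> pverts G \<and> v \<in> pverts G \<and> u \<noteq> v \<and> (u, v) \<notin> parcs G} \<rparr>"

definition edge_set :: "'a pair_pre_digraph \<Rightarrow> 'a set set" where
  "edge_set G = {{u, v} | u v. (u, v) \<in> parcs G}"

definition matching :: "'a pair_pre_digraph \<Rightarrow> 'a set set \<Rightarrow> bool" where
  "matching G M \<longleftrightarrow> M \<subseteq> edge_set G \<and> disjoint M"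

definition matching_number :: "'a pair_pre_digraph \<Rightarrow> nat" where
  "matching_number G = Max (card ` {M. matching G M})"

text \<open>Rows and columns are indexed by the vertices in increasing order.\<close>

definition adj_mat :: "'a::linorder pair_pre_digraph \<Rightarrow> real mat" where
  "adj_mat G = (let vs = sorted_list_of_set (pverts G); n = card (pverts G)
     in mat n n (\<lambda>(i, j). if (vs ! i, vs ! j) \<in> parcs G then 1 else 0))"

text \<open>
  The eigenvalues are counted with algebraic multiplicity. They are taken in the complex numbers,
  so that the multiset has \<open>card (pverts G)\<close> elements by definition, without appeal to the
  spectral theorem.
\<close>

definition Spec :: "'a::linorder pair_pre_digraph \<Rightarrow> complex multiset" where
  "Spec G = proots (char_poly (map_mat complex_of_real (adj_mat G)))"

definition generalized_spectrum ::
    "'a::linorder pair_pre_digraph \<Rightarrow> complex multiset \<times> complex multiset" where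
  "generalized_spectrum G = (Spec G, Spec (complement_graph G))"

definition ones :: "nat \<Rightarrow> real vec" where
  "ones n = vec n (\<lambda>_. 1)"

definition total_walks :: "nat \<Rightarrow> 'a::linorder pair_pre_digraph \<Rightarrow> real" where
  "total_walks k G = (let n = card (pverts G)
     in scalar_prod (ones n) ((adj_mat G ^\<^sub>m k) *\<^sub>v ones n))"

end

theory Submission
  imports Defs
begin

text \<open>
  Hang \<open>m\<close> leaves on the vertex \<open>u\<close>, respectively on \<open>v\<close>, of a fixed tree \<open>S\<close> with 11 vertices, in which
  \<open>u\<close> and \<open>v\<close> are exchanged by a rational symmetric orthogonal matrix \<open>Q\<close> that commutes with \<open>A(S)\<close> and fixes
  the all-one vector, although no automorphism of \<open>S\<close> exchanges them. Extended by the identity on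
  the new leaves, \<open>Q\<close> intertwines the two adjacency matrices and commutes with the all-one matrix,
  which yields equal spectra, complement spectra and walk counts at once. A matching of size 5
  already lies in \<open>S\<close>, and a vertex cover of size 5 contains \<open>u\<close> and \<open>v\<close>.
\<close>

section \<open>Matchings and isomorphisms\<close>

text \<open>Weak duality: choosing for each edge of \<open>M\<close> one of its vertices in
  \<open>C\<close> is injective, because distinct edges of a matching are disjoint.\<close>

lemma matching_card_le_cover:
  assumes M: "matching G M" and C: "finite C" and cover: "\<And>u v. (u, v) \<in> parcs G \<Longrightarrow> u \<in> C \<or> v \<in> C"
  shows "finite M" and "card M \<le> card C"
proof -
  have "\<exists>c. c \<in> e \<and> c \<in> C" if "e \<in> M" for e
  proof -
    obtain u v where "e = {u, v}" "(u, v) \<in> parcs G"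
      using \<open>e \<in> M\<close> M by (auto simp: matching_def edge_set_def)
    then show ?thesis using cover[of u v] by blast
  qed
  then obtain f where f: "\<And>e. e \<in> M \<Longrightarrow> f e \<in> e \<and> f e \<in> C"
    by metis
  have "inj_on f M"
  proof (rule inj_onI)
    fix d e assume de: "d \<in> M" "e \<in> M" "f d = f e"
    then have "d \<inter> e \<noteq> {}" using f[of d] f[of e] by auto
    then show "d = e" using de M by (auto simp: matching_def disjoint_def)
  qed
  moreover have "f ` M \<subseteq> C" using f by auto
  ultimately show "finite M" "card M \<le> card C"
    using C by (auto intro: inj_on_finite card_inj_on_le)
qed

text \<open>A cover of the same size certifies that \<open>M\<close> is maximum; the bound also
  gives the finiteness that \<open>Max\<close> requires.\<close>

lemma matching_number_eq_cover:
  assumes M: "matching G M" and C: "finite C" and cover: "\<And>u v. (u, v) \<in> parcs G \<Longrightarrow> u \<in> C \<or> v \<in> C"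
    and eq: "card M = card C"
  shows "matching_number G = card C"
  unfolding matching_number_def
proof (rule Max_eqI)
  have le: "card N \<le> card C" if "matching G N" for N
    using matching_card_le_cover(2)[OF that C cover] .
  then have "card ` {M. matching G M} \<subseteq> {..card C}" by auto
  then show "finite (card ` {M. matching G M})" by (rule finite_subset) simp
  show "y \<le> card C" if "y \<in> card ` {M. matching G M}" for y using that le by auto
  show "card C \<in> card ` {M. matching G M}" using M eq by (metis image_eqI mem_Collect_eq)
qed

section \<open>Neighbourhoods and degrees under isomorphism\<close>

definition neighbours :: "'a pair_pre_digraph \<Rightarrow> 'a \<Rightarrow> 'a set" where
  "neighbours G u = {v. (u, v) \<in> parcs G}"

text \<open>An isomorphism here carries separate maps for vertices, arcs, tails and heads. Since
  arcs are pairs, the vertex map determines the arc map, and injectivity does the rest.\<close>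

lemma digraph_iso_neighbours:
  assumes "digraph_iso (with_proj G) (with_proj H)"
  obtains f where "\<And>u. u \<in> pverts G \<Longrightarrow> neighbours H (f u) = f ` neighbours G u"
    "\<And>u. u \<in> pverts G \<Longrightarrow> card (neighbours H (f u)) = card (neighbours G u)"
proof -
  obtain h where iso: "pre_digraph.digraph_isomorphism (with_proj G) h"
    and H: "with_proj H = app_iso h (with_proj G)"
    using assms by (auto simp: digraph_iso_def)
  let ?f = "iso_verts h"
  have wf: "pair_wf_digraph G" and inj: "inj_on ?f (pverts G)"
    and ends: "\<And>a. a \<in> parcs G \<Longrightarrow> ?f (fst a) = iso_tail h (iso_arcs h a) \<and> ?f (snd a) = iso_head h (iso_arcs h a)"
    using iso by (auto simp: pre_digraph.digraph_isomorphism_def wf_digraph_wp_iff)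
  interpret pair_wf_digraph G by (rule wf)
  \<comment> \<open>Both graphs have \<open>fst\<close> and \<open>snd\<close> as tail and head
    functions, which forces the tail and head components of \<open>h\<close>.\<close>
  have H': "parcs H = iso_arcs h ` parcs G" "fst = iso_tail h" "snd = iso_head h"
    using arg_cong[OF H, of arcs] arg_cong[OF H, of tail] arg_cong[OF H, of head] by simp_all
  have "iso_arcs h a = (?f (fst a), ?f (snd a))" if "a \<in> parcs G" for a
    using ends[OF that] unfolding H'(2,3)[symmetric] by (simp add: prod_eq_iff)
  then have arcs: "parcs H = (\<lambda>a. (?f (fst a), ?f (snd a))) ` parcs G"
    unfolding H'(1) by (rule image_cong[OF refl])
  have nb: "neighbours H (?f u) = ?f ` neighbours G u" if u: "u \<in> pverts G" for u
  proof (intro equalityI subsetI)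
    fix x assume "x \<in> neighbours H (?f u)"
    then obtain v w where vw: "(v, w) \<in> parcs G" "?f v = ?f u" "x = ?f w"
      by (auto simp: neighbours_def arcs)
    then have "v = u" using inj_onD[OF inj vw(2)] in_arcsD1 u by blast
    then show "x \<in> ?f ` neighbours G u" using vw by (auto simp: neighbours_def)
  next
    fix x assume "x \<in> ?f ` neighbours G u"
    then obtain w where "(u, w) \<in> parcs G" "x = ?f w" by (auto simp: neighbours_def)
    then have "(?f u, x) \<in> parcs H" unfolding arcs by (intro image_eqI[of _ _ "(u, w)"]) simp_all
    then show "x \<in> neighbours H (?f u)" by (simp add: neighbours_def)
  qed
  have "neighbours G u \<subseteq> pverts G" for u by (auto simp: neighbours_def dest: in_arcsD2)
  then have "card (?f ` neighbours G u) = card (neighbours G u)" for u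
    using inj by (meson card_image inj_on_subset)
  then show ?thesis by (intro that[of ?f]) (simp_all only: nb)
qed

section \<open>Trees given by a parent function\<close>

definition parent_graph :: "nat \<Rightarrow> (nat \<Rightarrow> nat) \<Rightarrow> nat pair_pre_digraph" where
  "parent_graph n p = \<lparr> pverts = {..<n},
     parcs = {(i, j). i < n \<and> j < n \<and> (0 < i \<and> j = p i \<or> 0 < j \<and> i = p j)} \<rparr>"

lemma parent_graph_simps [simp]:
  "pverts (parent_graph n p) = {..<n}"
  "(i, j) \<in> parcs (parent_graph n p) \<longleftrightarrow> i < n \<and> j < n \<and> (0 < i \<and> j = p i \<or> 0 < j \<and> i = p j)"
  by (simp_all add: parent_graph_def)

lemma pcas_fst_nth:
  assumes "pcas u w v" "i < length w"
  shows "fst (w ! i) = (if i = 0 then u else snd (w ! (i - 1)))"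
  using assms
proof (induction w arbitrary: u i)
  case (Cons e w)
  then show ?case by (cases i) auto
qed simp

lemma pcas_snd_last: "pcas u w v \<Longrightarrow> w \<noteq> [] \<Longrightarrow> snd (last w) = v"
  by (induction w arbitrary: u) auto

lemma tl_pawalk_verts: "pcas u w v \<Longrightarrow> tl (pawalk_verts u w) = map snd w"
proof (induction w arbitrary: u)
  case (Cons e w)
  then show ?case by (cases w) auto
qed simp

context
  fixes n :: nat and p :: "nat \<Rightarrow> nat"
  assumes parent_less: "\<And>i. 0 < i \<Longrightarrow> i < n \<Longrightarrow> p i < i"
begin

lemma pair_graph_parent_graph: "pair_graph (parent_graph n p)"
proof
  have "parcs (parent_graph n p) \<subseteq> {..<n} \<times> {..<n}" by (auto simp: parent_graph_def)
  then show "finite (parcs (parent_graph n p))" by (rule finite_subset) simp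
  show "symmetric (with_proj (parent_graph n p))"
    by (auto simp: symmetric_def intro!: symI)
  show "fst e \<noteq> snd e" if "e \<in> parcs (parent_graph n p)" for e
    using that parent_less[of "fst e"] parent_less[of "snd e"] by (cases e) auto
qed (auto simp: parent_graph_def)

text \<open>Parents strictly decrease, so every vertex reaches the root \<open>0\<close>; symmetry
  of the arcs then joins any two vertices through it.\<close>

lemma connected_parent_graph:
  assumes "0 < n"
  shows "connected (with_proj (parent_graph n p))"
proof -
  interpret pair_graph "parent_graph n p" by (rule pair_graph_parent_graph)
  have root: "u \<rightarrow>\<^sup>*\<^bsub>parent_graph n p\<^esub> 0" if "u < n" for u
    using that
  proof (induction u rule: less_induct)
    case (less u)
    show ?case
    proof (cases "u = 0")
      case True
      then show ?thesis using less.prems by auto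
    next
      case False
      then have "p u < u" using less.prems parent_less by auto
      have "(u, p u) \<in> parcs (parent_graph n p)"
        using False less.prems \<open>p u < u\<close> by auto
      moreover have "p u \<rightarrow>\<^sup>*\<^bsub>parent_graph n p\<^esub> 0"
        using less.IH[of "p u"] less.prems \<open>p u < u\<close> by simp
      ultimately show ?thesis by (rule adj_reachable_trans)
    qed
  qed
  have "u \<rightarrow>\<^sup>*\<^bsub>parent_graph n p\<^esub> v" if "u < n" "v < n" for u v
    using root[OF that(1)] root[OF that(2)] by (meson reachable_trans symmetric_reachable sym_arcs)
  then have "strongly_connected (with_proj (parent_graph n p))"
    using assms by (auto simp: strongly_connected_def)
  then show ?thesis
    by (auto simp: connected_def strongly_connected_def reachable_mk_symmetricI)
qed

text \<open>Both neighbours of the largest vertex of a cycle would be its parent.\<close>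

lemma no_long_cycle_parent_graph:
  assumes cyc: "pre_digraph.cycle (with_proj (parent_graph n p)) w" and len: "3 \<le> length w"
  shows False
proof -
  interpret pair_graph "parent_graph n p" by (rule pair_graph_parent_graph)
  obtain u where walk: "awalk u w u" and dist: "distinct (tl (pawalk_verts u w))"
    using cyc by (auto simp: cycle_def)
  have arcs: "set w \<subseteq> parcs (parent_graph n p)" and cas: "pcas u w u"
    using walk by (auto simp: awalk_def)
  define L where "L = length w"
  \<comment> \<open>Taking heads of arcs lists each vertex of the closed walk once. The wrap-around
    of \<open>pred\<close> at \<open>0\<close> reflects that the walk ends where it starts.\<close>
  define v where "v i = snd (w ! i)" for i
  define pred where "pred i = (if i = 0 then L - 1 else i - 1)" for i
  have ne: "w \<noteq> []" using len by auto
  have arc: "(v (pred i), v i) \<in> parcs (parent_graph n p)" if "i < L" for i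
  proof -
    have "fst (w ! i) = v (pred i)"
      using pcas_fst_nth[OF cas, of i] pcas_snd_last[OF cas ne] that ne
      by (auto simp: v_def pred_def L_def last_conv_nth)
    moreover have "w ! i \<in> set w" using that by (simp add: L_def)
    ultimately show ?thesis using arcs by (metis v_def prod.collapse subsetD)
  qed
  have inj: "i = j" if "v i = v j" "i < L" "j < L" for i j
    using nth_eq_iff_index_eq[OF dist, of i j] that
    by (simp add: tl_pawalk_verts[OF cas] v_def L_def)
  have "Max (v ` {..<L}) \<in> v ` {..<L}" using len by (intro Max_in) (auto simp: L_def lessThan_empty_iff)
  then obtain i where i: "i < L" "v i = Max (v ` {..<L})" by auto
  have max: "v j \<le> v i" if "j < L" for j using that i by simp
  \<comment> \<open>With at least three arcs, the cyclic successor and predecessor of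
    \<open>i\<close> are different.\<close>
  define nxt where "nxt = (if i + 1 = L then 0 else i + 1)"
  have bounds: "nxt < L" "pred i < L" "pred nxt = i" "nxt \<noteq> pred i"
    using i(1) len by (auto simp: nxt_def pred_def L_def)
  \<comment> \<open>The only other kind of neighbour, a child of \<open>v i\<close>, would be larger
    than \<open>v i\<close>.\<close>
  have parent: "x = p (v i)" if "(v i, x) \<in> parcs (parent_graph n p)" "x \<le> v i" for x
    using that parent_less[of x] by auto
  have "v nxt = p (v i)" using arc[OF bounds(1)] bounds max by (intro parent) auto
  moreover have "v (pred i) = p (v i)"
    using arc[OF i(1)] arcs_symmetric bounds max by (intro parent) auto
  ultimately show False using inj[of nxt "pred i"] bounds by simp
qed

lemma is_tree_parent_graph:
  assumes "0 < n"
  shows "is_tree (parent_graph n p)"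
  unfolding is_tree_def
proof (intro conjI notI)
  assume "\<exists>w. pre_digraph.cycle (with_proj (parent_graph n p)) w \<and> 3 \<le> length w"
  then obtain w where "pre_digraph.cycle (with_proj (parent_graph n p)) w" "3 \<le> length w"
    by (elim exE conjE)
  then show False by (rule no_long_cycle_parent_graph)
qed (rule pair_graph_parent_graph connected_parent_graph[OF assms])+

end

section \<open>Cospectrality by a symmetric orthogonal matrix fixing the all-one vector\<close>

lemma adj_mat_carrier [simp]: "adj_mat G \<in> carrier_mat (card (pverts G)) (card (pverts G))"
  by (simp add: adj_mat_def Let_def)

text \<open>Subtracting the identity clears the diagonal of the all-one matrix; the adjacency matrix
  must already vanish there, hence the absence of loops.\<close>

lemma adj_mat_complement_graph:
  assumes "finite (pverts G)" and loopfree: "\<And>u. (u, u) \<notin> parcs G"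
  defines "n \<equiv> card (pverts G)"
  shows "adj_mat (complement_graph G) = mat n n (\<lambda>_. 1) - 1\<^sub>m n - adj_mat G"
proof -
  let ?vs = "sorted_list_of_set (pverts G)"
  have "?vs ! i \<in> pverts G" if "i < n" for i
    using that assms(1) by (metis n_def nth_mem set_sorted_list_of_set sorted_list_of_set.length_sorted_key_list_of_set)
  moreover have "?vs ! i = ?vs ! j \<longleftrightarrow> i = j" if "i < n" "j < n" for i j
    using that by (simp add: n_def nth_eq_iff_index_eq)
  ultimately show ?thesis
    using loopfree by (intro eq_matI) (auto simp: adj_mat_def complement_graph_def Let_def n_def)
qed

text \<open>Brings the complex spectrum back to the real matrix, so that a real similarity
  suffices.\<close>

lemma Spec_conv_real_char_poly:
  "Spec G = proots (map_poly complex_of_real (char_poly (adj_mat G)))"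
  unfolding Spec_def by (subst of_real_hom.char_poly_hom[OF adj_mat_carrier]) simp

lemma Spec_eqI:
  assumes "similar_mat (adj_mat G) (adj_mat H)"
  shows "Spec G = Spec H"
  by (simp add: Spec_conv_real_char_poly char_poly_similar[OF assms])

context
  fixes G :: "'a::linorder pair_pre_digraph" and H :: "'b::linorder pair_pre_digraph"
    and Q :: "real mat" and n :: nat
  assumes cards: "card (pverts G) = n" "card (pverts H) = n"
    and Q: "Q \<in> carrier_mat n n" and sym: "transpose_mat Q = Q" and invol: "Q * Q = 1\<^sub>m n"
    and Q_ones: "Q *\<^sub>v ones n = ones n"
    and intertwine: "adj_mat G * Q = Q * adj_mat H"
begin

private lemma adj_carrier: "adj_mat G \<in> carrier_mat n n" "adj_mat H \<in> carrier_mat n n"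
  using adj_mat_carrier[of G] adj_mat_carrier[of H] cards by simp_all

text \<open>\<open>Q\<close> is its own inverse, so intertwining by \<open>Q\<close> is conjugation
  by \<open>Q\<close>.\<close>

private lemma similar_of_intertwine:
  assumes "A \<in> carrier_mat n n" "B \<in> carrier_mat n n" "A * Q = Q * B"
  shows "similar_mat A B"
proof (rule similar_matI)
  have "A = A * (Q * Q)" using assms(1) by (simp add: invol)
  also have "\<dots> = A * Q * Q" by (rule assoc_mult_mat[OF assms(1) Q Q, symmetric])
  finally show "A = Q * B * Q" unfolding assms(3) .
qed (use assms(1,2) Q invol in auto)

lemma Spec_eq_of_intertwine: "Spec G = Spec H"
  by (intro Spec_eqI similar_of_intertwine adj_carrier intertwine)

text \<open>Symmetry turns the unit row sums of \<open>Q\<close> into unit column sums, so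
  \<open>J * Q = J = Q * J\<close>, and \<open>Q\<close> intertwines the adjacency matrices of the
  complements as well.\<close>

lemma Spec_complement_eq_of_intertwine:
  assumes "finite (pverts G)" "\<And>u. (u, u) \<notin> parcs G" "finite (pverts H)" "\<And>u. (u, u) \<notin> parcs H"
  shows "Spec (complement_graph G) = Spec (complement_graph H)"
proof -
  define J :: "real mat" where "J = mat n n (\<lambda>_. 1)"
  have J: "J \<in> carrier_mat n n" and J1: "J - 1\<^sub>m n \<in> carrier_mat n n"
    by (auto simp: J_def)
  have row: "row Q i \<bullet> ones n = 1" if "i < n" for i
    using arg_cong[OF Q_ones, of "\<lambda>v. v $ i"] that Q by (simp add: ones_def)
  have "col Q j = row Q j" if "j < n" for j
    using sym that Q by (metis carrier_matD(1) row_transpose carrier_matD(2))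
  then have "J * Q = J" using row Q
    by (intro eq_matI) (auto simp: J_def row_def ones_def scalar_prod_def)
  moreover have "Q * J = J" using row Q
    by (intro eq_matI) (auto simp: J_def col_def ones_def scalar_prod_def)
  moreover have "(J - 1\<^sub>m n - adj_mat G) * Q = J * Q - Q - adj_mat G * Q"
    using minus_mult_distrib_mat[OF J1 adj_carrier(1) Q]
      minus_mult_distrib_mat[OF J one_carrier_mat Q] Q by simp
  moreover have "Q * (J - 1\<^sub>m n - adj_mat H) = Q * J - Q - Q * adj_mat H"
    using mult_minus_distrib_mat[OF Q J1 adj_carrier(2)]
      mult_minus_distrib_mat[OF Q J one_carrier_mat] Q by simp
  ultimately have "(J - 1\<^sub>m n - adj_mat G) * Q = Q * (J - 1\<^sub>m n - adj_mat H)"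
    by (simp add: intertwine)
  then have "similar_mat (J - 1\<^sub>m n - adj_mat G) (J - 1\<^sub>m n - adj_mat H)"
    using adj_carrier by (intro similar_of_intertwine) auto
  moreover have "adj_mat (complement_graph G) = J - 1\<^sub>m n - adj_mat G"
    "adj_mat (complement_graph H) = J - 1\<^sub>m n - adj_mat H"
    using adj_mat_complement_graph[OF assms(1,2)] adj_mat_complement_graph[OF assms(3,4)]
    by (simp_all only: cards J_def)
  ultimately show ?thesis by (intro Spec_eqI) simp
qed

text \<open>The intertwining passes to powers; the all-one vector on either side then absorbs
  \<open>Q\<close>.\<close>

lemma total_walks_eq_of_intertwine: "total_walks k G = total_walks k H"
proof -
  let ?A = "adj_mat G ^\<^sub>m k" and ?B = "adj_mat H ^\<^sub>m k"
  have AB: "?A \<in> carrier_mat n n" "?B \<in> carrier_mat n n" using adj_carrier by auto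
  have pow: "?A * Q = Q * ?B"
  proof (induction k)
    case 0
    then show ?case using Q adj_carrier by simp
  next
    case (Suc k)
    let ?A = "adj_mat G ^\<^sub>m k" and ?B = "adj_mat H ^\<^sub>m k"
    have AB: "?A \<in> carrier_mat n n" "?B \<in> carrier_mat n n" using adj_carrier by auto
    have "?A * adj_mat G * Q = ?A * (Q * adj_mat H)"
      using assoc_mult_mat[OF AB(1) adj_carrier(1) Q] intertwine by simp
    also have "\<dots> = Q * ?B * adj_mat H"
      using assoc_mult_mat[OF AB(1) Q adj_carrier(2)] Suc by simp
    also have "\<dots> = Q * (?B * adj_mat H)"
      using assoc_mult_mat[OF Q AB(2) adj_carrier(2)] by simp
    finally show ?case by simp
  qed
  have o: "ones n \<in> carrier_vec n" by (simp add: ones_def)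
  have "?A *\<^sub>v ones n = Q *\<^sub>v (?B *\<^sub>v ones n)"
    using assoc_mult_mat_vec[OF AB(1) Q o] assoc_mult_mat_vec[OF Q AB(2) o] pow Q_ones by simp
  then have "ones n \<bullet> (?A *\<^sub>v ones n) = (transpose_mat Q *\<^sub>v ones n) \<bullet> (?B *\<^sub>v ones n)"
    using transpose_vec_mult_scalar[OF Q _ o, of "?B *\<^sub>v ones n"] AB o by simp
  then show ?thesis by (simp add: total_walks_def Let_def cards sym Q_ones)
qed

end

section \<open>Two trees sharing a core\<close>

text \<open>The core is the tree \<open>S\<close>, on the vertices \<open>0, \<dots>, 10\<close> and with \<open>u = 3\<close> and \<open>v = 7\<close>; in \<open>broom m c\<close>
  the new leaves \<open>11, \<dots>, 10 + m\<close> hang on the core vertex \<open>c\<close>.\<close>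

definition core_parent :: "nat \<Rightarrow> nat" where
  "core_parent i = [0, 0, 0, 2, 3, 4, 4, 0, 7, 8, 9] ! i"

text \<open>At the root \<open>0\<close> hang the leaf \<open>1\<close>, the path
  \<open>2, 3, 4\<close> whose end carries the leaves \<open>5, 6\<close>, and the path
  \<open>7, 8, 9, 10\<close>. Neighbour lists give degrees and matrix entries directly.\<close>

definition core_adj :: "nat \<Rightarrow> nat list" where
  "core_adj i = [[1, 2, 7], [0], [0, 3], [2, 4], [3, 5, 6], [4], [4], [0, 8], [7, 9], [8, 10], [9]] ! i"

text \<open>Scaled by 7 to integers, so that its identities can be decided by evaluation.\<close>

definition core_mix :: "nat \<Rightarrow> nat \<Rightarrow> int" where
  "core_mix i j =
    [[ 2,  3,  3, 0,  4, -1, -1, 0, -2,  1, -2],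
     [ 3,  1,  1, 0, -1,  2,  2, 0, -3, -2,  4],
     [ 3,  1,  1, 0, -1,  2,  2, 0,  4, -2, -3],
     [ 0,  0,  0, 0,  0,  0,  0, 7,  0,  0,  0],
     [ 4, -1, -1, 0,  1, -2, -2, 0,  3,  2,  3],
     [-1,  2,  2, 0, -2,  4, -3, 0,  1,  3,  1],
     [-1,  2,  2, 0, -2, -3,  4, 0,  1,  3,  1],
     [ 0,  0,  0, 7,  0,  0,  0, 0,  0,  0,  0],
     [-2, -3,  4, 0,  3,  1,  1, 0,  2, -1,  2],
     [ 1, -2, -2, 0,  2,  3,  3, 0, -1,  4, -1],
     [-2,  4, -3, 0,  3,  1,  1, 0,  2, -1,  2]] ! i ! j"

text \<open>The finite verification behind the construction, phrased with lists for evaluation. The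
  values 7 and \<open>49 = 7^2\<close> come from the scaling of \<open>core_mix\<close>.\<close>

lemma core_checks:
  "\<forall>i\<in>set [0..<11]. \<forall>j\<in>set [0..<11].
     (0 < i \<and> j = core_parent i \<or> 0 < j \<and> i = core_parent j) = (j \<in> set (core_adj i)) \<and>
     core_mix i j = core_mix j i \<and>
     sum_list (map (\<lambda>k. core_mix i k * core_mix k j) [0..<11]) = (if i = j then 49 else 0) \<and>
     sum_list (map (\<lambda>k. of_bool (k \<in> set (core_adj i)) * core_mix k j) [0..<11]) =
     sum_list (map (\<lambda>k. core_mix i k * of_bool (j \<in> set (core_adj k))) [0..<11])"
  "\<forall>i\<in>set [0..<11]. sum_list (map (core_mix i) [0..<11]) = 7 \<and>
     core_mix i 7 = (if i = 3 then 7 else 0) \<and> core_mix 3 i = (if i = 7 then 7 else 0) \<and>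
     distinct (core_adj i) \<and> set (core_adj i) \<subseteq> {..<11} \<and> (0 < i \<longrightarrow> core_parent i < i) \<and>
     (i \<in> {0,3,4,7,9} \<or> core_parent i \<in> {0,3,4,7,9})"
  by code_simp+

lemma core_parent_iff_adj:
  "i < 11 \<Longrightarrow> j < 11 \<Longrightarrow> 0 < i \<and> j = core_parent i \<or> 0 < j \<and> i = core_parent j \<longleftrightarrow> j \<in> set (core_adj i)"
  using bspec[OF bspec[OF core_checks(1), of i], of j] by simp

lemma core_parent_less: "0 < i \<Longrightarrow> i < 11 \<Longrightarrow> core_parent i < i"
  and core_cover: "i < 11 \<Longrightarrow> i \<in> {0, 3, 4, 7, 9} \<or> core_parent i \<in> {0, 3, 4, 7, 9}"
  and core_adj_less: "i < 11 \<Longrightarrow> set (core_adj i) \<subseteq> {..<11}"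
  and distinct_core_adj: "i < 11 \<Longrightarrow> distinct (core_adj i)"
  using bspec[OF core_checks(2), of i] by simp_all

section \<open>Attaching the new leaves: adjacency, degrees and matchings\<close>

definition attach :: "nat \<Rightarrow> nat \<Rightarrow> nat" where
  "attach c i = (if i < 11 then core_parent i else c)"

definition broom :: "nat \<Rightarrow> nat \<Rightarrow> nat pair_pre_digraph" where
  "broom m c = parent_graph (11 + m) (attach c)"

lemma pverts_broom [simp]: "pverts (broom m c) = {..<11 + m}"
  by (simp add: broom_def)

lemma parcs_broom_bounds: "(i, j) \<in> parcs (broom m c) \<Longrightarrow> i < 11 + m \<and> j < 11 + m"
  by (simp add: broom_def)

lemma parcs_broom_core: "i < 11 \<Longrightarrow> j < 11 \<Longrightarrow> (i, j) \<in> parcs (broom m c) \<longleftrightarrow> j \<in> set (core_adj i)"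
  using core_parent_iff_adj[of i j] by (simp add: broom_def attach_def)

context
  fixes c :: nat
  assumes c: "c < 11"
begin

lemma attach_less: "0 < i \<Longrightarrow> attach c i < i"
  using c core_parent_less[of i] by (auto simp: attach_def)

lemma is_tree_broom: "is_tree (broom m c)"
  unfolding broom_def using attach_less by (intro is_tree_parent_graph) auto

lemma no_loop_broom: "(u, u) \<notin> parcs (broom m c)"
  using attach_less[of u] by (auto simp: broom_def)

lemma parcs_broom_leaf:
  "i < 11 \<Longrightarrow> 11 \<le> j \<Longrightarrow> j < 11 + m \<Longrightarrow> (i, j) \<in> parcs (broom m c) \<longleftrightarrow> i = c"
  "11 \<le> i \<Longrightarrow> i < 11 + m \<Longrightarrow> (i, j) \<in> parcs (broom m c) \<longleftrightarrow> j = c"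
  using c core_parent_less[of i] core_parent_less[of j] by (auto simp: broom_def attach_def)

lemma neighbours_broom_core:
  assumes "i < 11"
  shows "neighbours (broom m c) i = set (core_adj i) \<union> (if i = c then {11..<11 + m} else {})"
proof -
  have "j \<in> neighbours (broom m c) i \<longleftrightarrow> j \<in> set (core_adj i) \<or> i = c \<and> j \<in> {11..<11 + m}" for j
  proof -
    consider "j < 11" | "11 \<le> j" "j < 11 + m" | "11 + m \<le> j" by linarith
    then show ?thesis
    proof cases
      case 1
      then show ?thesis by (simp add: neighbours_def parcs_broom_core[OF assms])
    next
      case 2
      then have "j \<notin> set (core_adj i)" using core_adj_less[OF assms] by auto
      then show ?thesis using 2 by (simp add: neighbours_def parcs_broom_leaf(1)[OF assms])
    next
      case 3
      then have "j \<notin> set (core_adj i)" using core_adj_less[OF assms] by auto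
      then show ?thesis using 3 parcs_broom_bounds[of i j m c] by (auto simp: neighbours_def)
    qed
  qed
  then show ?thesis by (simp add: set_eq_iff)
qed

lemma neighbours_broom_leaf:
  assumes "11 \<le> i" "i < 11 + m"
  shows "neighbours (broom m c) i = {c}"
  using parcs_broom_leaf(2)[OF assms] by (simp add: neighbours_def)

lemma card_neighbours_broom_core:
  assumes "i < 11"
  shows "card (neighbours (broom m c) i) = length (core_adj i) + (if i = c then m else 0)"
proof -
  have "set (core_adj i) \<inter> {11..<11 + m} = {}" using core_adj_less[OF assms] by fastforce
  then show ?thesis
    using distinct_core_adj[OF assms]
    using c by (cases "i = c") (simp_all add: neighbours_broom_core assms card_Un_disjoint distinct_card)
qed

lemma matching_number_broom:
  assumes "c \<in> {0, 3, 4, 7, 9}"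
  shows "matching_number (broom m c) = 5"
proof -
  \<comment> \<open>Each of these five core edges contains exactly one vertex of
    \<open>C\<close>.\<close>
  let ?M = "{{0, 1}, {2, 3}, {4, 5}, {7, 8}, {9, 10}} :: nat set set"
  define C :: "nat set" where "C = {0, 3, 4, 7, 9}"
  have "{i, j} \<in> edge_set (broom m c)" if "i < 11" "j < 11" "j \<in> set (core_adj i)" for i j
    using parcs_broom_core[OF that(1,2)] that(3) by (auto simp: edge_set_def)
  then have "?M \<subseteq> edge_set (broom m c)" by (simp add: core_adj_def)
  moreover have "disjoint ?M" by (simp add: disjoint_def)
  ultimately have "matching (broom m c) ?M" by (simp add: matching_def)
  moreover have "finite C" and "card C = 5" by (simp_all add: C_def)
  moreover have "card ?M = 5" by (simp add: doubleton_eq_iff)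
  moreover have "u \<in> C \<or> v \<in> C" if "(u, v) \<in> parcs (broom m c)" for u v
  proof -
    \<comment> \<open>Every edge joins a vertex to its parent: \<open>core_cover\<close> treats the
      core, and the parent \<open>c\<close> of a new leaf lies in \<open>C\<close> by
      assumption.\<close>
    have cover: "i \<in> C \<or> attach c i \<in> C" for i
      using assms core_cover[of i] unfolding attach_def C_def by presburger
    have "v = attach c u \<or> u = attach c v" using that by (auto simp: broom_def)
    then show ?thesis using cover[of u] cover[of v] by auto
  qed
  ultimately show ?thesis using matching_number_eq_cover[of "broom m c" ?M C] by simp
qed

text \<open>Block form; the last case also covers pairs of new leaves, where \<open>j = c\<close>
  fails because \<open>c < 11\<close>.\<close>

lemma adj_mat_broom:
  "adj_mat (broom m c) = mat (11 + m) (11 + m) (\<lambda>(i, j).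
     if i < 11 \<and> j < 11 then of_bool (j \<in> set (core_adj i))
     else if i < 11 then of_bool (i = c) else of_bool (j = c))"
proof -
  have "sorted_list_of_set {..<11 + m} = [0..<11 + m]" by (simp add: lessThan_atLeast0)
  moreover have "[0..<11 + m] ! i = i" if "i < 11 + m" for i using nth_upt[of 0 i "11 + m"] that by simp
  ultimately show ?thesis
    using c
    by (intro eq_matI) (auto simp: adj_mat_def Let_def parcs_broom_core parcs_broom_leaf not_less)
qed

end

text \<open>A vertex of degree 3 next to a vertex of degree at least 3 and to two leaves exists only if the
  new leaves hang on vertex 3.\<close>

lemma broom_not_iso:
  assumes "1 \<le> m"
  shows "\<not> digraph_iso (with_proj (broom m 3)) (with_proj (broom m 7))"
proof
  assume "digraph_iso (with_proj (broom m 3)) (with_proj (broom m 7))"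
  then obtain f where f: "\<And>u. u \<in> pverts (broom m 3) \<Longrightarrow> neighbours (broom m 7) (f u) = f ` neighbours (broom m 3) u"
    "\<And>u. u \<in> pverts (broom m 3) \<Longrightarrow> card (neighbours (broom m 7) (f u)) = card (neighbours (broom m 3) u)"
    by (rule digraph_iso_neighbours) (rule that)
  note img = f(1)[unfolded pverts_broom lessThan_iff] and deg = f(2)[unfolded pverts_broom lessThan_iff]
  \<comment> \<open>In \<open>broom m 3\<close> the vertex \<open>4\<close> has degree 3; its
    neighbours are \<open>3\<close>, of degree \<open>2 + m\<close>, and the leaves \<open>5\<close>
    and \<open>6\<close>.\<close>
  define x where "x = f 4"
  define y where "y = f 3"
  note core3 = neighbours_broom_core[of 3 _ m] card_neighbours_broom_core[of 3 _ m]
  note core7 = neighbours_broom_core[of 7 _ m] card_neighbours_broom_core[of 7 _ m]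
  have x: "card (neighbours (broom m 7) x) = 3" using deg[of 4] by (simp add: x_def core3 core_adj_def)
  have y: "3 \<le> card (neighbours (broom m 7) y)" using deg[of 3] assms by (simp add: y_def core3 core_adj_def)
  have nx: "neighbours (broom m 7) x = {y, f 5, f 6}"
    using img[of 4] by (simp add: x_def y_def core3 core_adj_def)
  have leaf: "card (neighbours (broom m 7) z) = 1" if "z \<in> neighbours (broom m 7) x" "z \<noteq> y" for z
    using that deg[of 5] deg[of 6] by (auto simp: nx core3 core_adj_def)
  have "y \<in> neighbours (broom m 7) x" by (simp add: nx)
  then have "x < 11 + m" using parcs_broom_bounds[of x y m 7] by (simp add: neighbours_def)
  then have "x < 11" using x neighbours_broom_leaf[of 7 x m] by (cases "x < 11") auto
  then have "x = 0 \<or> x = 1 \<or> x = 2 \<or> x = 3 \<or> x = 4 \<or> x = 5 \<or> x = 6 \<or> x = 7 \<or> x = 8 \<or> x = 9 \<or> x = 10"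
    by presburger
  \<comment> \<open>In \<open>broom m 7\<close> the degree of \<open>7\<close> is
    \<open>2 + m\<close>, hence the condition on \<open>m\<close>.\<close>
  then have "x = 0 \<or> x = 4 \<or> x = 7 \<and> m = 1"
    using x by (elim disjE) (simp_all add: core7 core_adj_def)
  \<comment> \<open>Only \<open>y\<close> may be a non-leaf next to \<open>x\<close>. But
    \<open>0\<close> has the non-leaf neighbours \<open>2\<close> and \<open>7\<close>, and
    \<open>7\<close> has \<open>0\<close> and \<open>8\<close>; the neighbours of \<open>4\<close>
    all have degree below 3.\<close>
  then show False
  proof (elim disjE conjE)
    assume x0: "x = 0"
    have "y = 7" using leaf[of 7] assms by (auto simp: x0 core7 core_adj_def)
    then show False using leaf[of 2] by (simp add: x0 core7 core_adj_def)
  next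
    assume x4: "x = 4"
    have "y \<in> {3, 5, 6}" using \<open>y \<in> _\<close> by (simp add: x4 core7 core_adj_def)
    then show False using y by (auto simp: core7 core_adj_def)
  next
    assume x7: "x = 7" and m: "m = 1"
    have "y = 0" using leaf[of 0] by (auto simp: x7 core7 core_adj_def)
    then show False using leaf[of 8] by (simp add: x7 core7 core_adj_def)
  qed
qed

text \<open>On the core, \<open>mix\<close> is the identity minus twice the orthogonal projection onto the Krylov space of
  \<open>e\<^sub>3 - e\<^sub>7\<close>. That space is invariant under the adjacency matrix and orthogonal to the all-one vector
  and to \<open>e\<^sub>3 + e\<^sub>7\<close>; hence \<open>mix\<close> commutes with the core and swaps \<open>e\<^sub>3\<close> and \<open>e\<^sub>7\<close>.
  The integer table \<open>core_mix\<close> is 7 times this matrix.\<close>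

definition mix :: "nat \<Rightarrow> nat \<Rightarrow> real" where
  "mix i j = (if i < 11 \<and> j < 11 then of_int (core_mix i j) / 7 else of_bool (i = j))"

section \<open>Algebra of the mixing matrix on the core and the new leaves\<close>

lemma sum_split_core: "(\<Sum>k = 0..<11 + m. f k) = (\<Sum>k = 0..<11. f k) + (\<Sum>k = 11..<11 + m. f k)"
  for f :: "nat \<Rightarrow> real"
  by (rule sum.atLeastLessThan_concat[symmetric]) simp_all

lemma core_sums:
  assumes "i < 11"
  shows "(\<Sum>k = 0..<11. core_mix i k) = 7"
    and "core_mix i 7 = (if i = 3 then 7 else 0)" and "core_mix 3 i = (if i = 7 then 7 else 0)"
    and "j < 11 \<Longrightarrow> core_mix i j = core_mix j i"
    and "j < 11 \<Longrightarrow> (\<Sum>k = 0..<11. core_mix i k * core_mix k j) = (if i = j then 49 else 0)"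
    and "j < 11 \<Longrightarrow> (\<Sum>k = 0..<11. of_bool (k \<in> set (core_adj i)) * core_mix k j) =
      (\<Sum>k = 0..<11. core_mix i k * of_bool (j \<in> set (core_adj k)))"
  using assms bspec[OF core_checks(2), of i] bspec[OF bspec[OF core_checks(1), of i], of j]
  by (simp_all add: interv_sum_list_conv_sum_set_nat)

lemma mix_row_sum:
  assumes "i < 11 + m"
  shows "(\<Sum>k = 0..<11 + m. mix i k) = 1"
proof (cases "i < 11")
  case True
  have "(\<Sum>k = 0..<11. mix i k) = of_int (\<Sum>k = 0..<11. core_mix i k) / 7"
    using True by (simp add: mix_def sum_divide_distrib)
  moreover have "(\<Sum>k = 11..<11 + m. mix i k) = 0" using True by (simp add: mix_def)
  ultimately show ?thesis unfolding sum_split_core by (simp add: core_sums(1)[OF True])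
next
  case False
  then have "(\<Sum>k = 0..<11 + m. mix i k) = (\<Sum>k = 0..<11 + m. if i = k then 1 else 0)"
    by (intro sum.cong) (auto simp: mix_def)
  then show ?thesis using assms by simp
qed

lemma mix_sym: "mix i j = mix j i"
  using core_sums(4)[of i j] by (auto simp: mix_def)

text \<open>The column of \<open>mix\<close> at a new leaf is a unit vector.\<close>

lemma mix_mult_right:
  assumes "11 \<le> j" "j < 11 + m"
  shows "(\<Sum>k = 0..<11 + m. f k * mix k j) = f j"
proof -
  have "(\<Sum>k = 0..<11 + m. f k * mix k j) = (\<Sum>k = 0..<11 + m. if k = j then f k else 0)"
    using assms by (intro sum.cong) (auto simp: mix_def)
  then show ?thesis using assms by simp
qed

lemma mix_mult_left:
  assumes "11 \<le> i" "i < 11 + m"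
  shows "(\<Sum>k = 0..<11 + m. mix i k * f k) = f i"
  using mix_mult_right[OF assms, of f] by (simp add: mix_sym[of i] mult.commute)

lemma mix_involution:
  assumes "i < 11 + m" "j < 11 + m"
  shows "(\<Sum>k = 0..<11 + m. mix i k * mix k j) = of_bool (i = j)"
proof (cases "i < 11 \<and> j < 11")
  case True
  then have "(\<Sum>k = 0..<11. mix i k * mix k j) = of_int (\<Sum>k = 0..<11. core_mix i k * core_mix k j) / 49"
    by (simp add: mix_def sum_divide_distrib)
  moreover have "(\<Sum>k = 11..<11 + m. mix i k * mix k j) = 0" using True by (simp add: mix_def)
  ultimately show ?thesis using True unfolding sum_split_core
    by (cases "i = j") (simp_all add: core_sums(5))
next
  case False
  then show ?thesis
    using assms mix_mult_right[of j m "mix i"] mix_mult_left[of i m "\<lambda>k. mix k j"]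
    by (cases "j < 11") (auto simp: mix_def)
qed

text \<open>Checked block by block. The core blocks commute; in the mixed blocks \<open>Q\<close>
  sends the unit vector at \<open>7\<close> to the one at \<open>3\<close> and conversely, which
  moves the attachment point; the block of new leaves is zero.\<close>

lemma broom_intertwine:
  defines "Q m \<equiv> mat (11 + m) (11 + m) (\<lambda>(i, j). mix i j)"
  shows "adj_mat (broom m 3) * Q m = Q m * adj_mat (broom m 7)"
proof -
  define A where "A c i j = (if i < 11 \<and> j < 11 then of_bool (j \<in> set (core_adj i))
     else if i < 11 then of_bool (i = c) else of_bool (j = c) :: real)" for c i j :: nat
  have "(\<Sum>k = 0..<11 + m. A 3 i k * mix k j) = (\<Sum>k = 0..<11 + m. mix i k * A 7 k j)"
    if ij: "i < 11 + m" "j < 11 + m" for i j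
  proof -
    consider "i < 11" "j < 11" | "i < 11" "11 \<le> j" | "11 \<le> i" "j < 11" | "11 \<le> i" "11 \<le> j"
      by linarith
    then show ?thesis
    proof cases
      case 1
      have "(\<Sum>k = 0..<11. A 3 i k * mix k j) =
          of_int (\<Sum>k = 0..<11. of_bool (k \<in> set (core_adj i)) * core_mix k j) / 7"
        unfolding of_int_sum sum_divide_distrib using 1 by (intro sum.cong) (auto simp: A_def mix_def)
      also have "\<dots> = (\<Sum>k = 0..<11. mix i k * A 7 k j)"
        unfolding core_sums(6)[OF 1] of_int_sum sum_divide_distrib
        using 1 by (intro sum.cong) (auto simp: A_def mix_def)
      finally show ?thesis using 1 unfolding sum_split_core by (simp add: mix_def)
    next
      case 2
      have "(\<Sum>k = 0..<11. mix i k * A 7 k j) = (\<Sum>k = 0..<11. if k = 7 then mix i k else 0)"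
        using 2 by (intro sum.cong) (auto simp: A_def)
      also have "\<dots> = of_bool (i = 3)" using 2 by (simp add: mix_def core_sums(2))
      finally have "(\<Sum>k = 0..<11 + m. mix i k * A 7 k j) = of_bool (i = 3)"
        using 2 unfolding sum_split_core by (simp add: mix_def)
      then show ?thesis using 2 ij by (simp add: mix_mult_right A_def)
    next
      case 3
      have "(\<Sum>k = 0..<11. A 3 i k * mix k j) = (\<Sum>k = 0..<11. if k = 3 then mix k j else 0)"
        using 3 by (intro sum.cong) (auto simp: A_def)
      also have "\<dots> = of_bool (j = 7)" using 3 by (simp add: mix_def core_sums(3))
      finally have "(\<Sum>k = 0..<11 + m. A 3 i k * mix k j) = of_bool (j = 7)"
        using 3 unfolding sum_split_core by (simp add: mix_def)
      then show ?thesis using 3 ij by (simp add: mix_mult_left A_def)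
    next
      case 4
      have "(\<Sum>k = 0..<11 + m. A 3 i k * mix k j) = A 3 i j"
        using 4 ij by (intro mix_mult_right) auto
      moreover have "(\<Sum>k = 0..<11 + m. mix i k * A 7 k j) = A 7 i j"
        using 4 ij by (intro mix_mult_left) auto
      ultimately show ?thesis using 4 by (simp add: A_def)
    qed
  qed
  then show ?thesis
    by (intro eq_matI) (simp_all add: adj_mat_broom Q_def A_def scalar_prod_def)
qed

theorem theorem1p4:
  fixes m :: nat
  assumes "m \<ge> 1"
  shows "\<exists>(T :: nat pair_pre_digraph) (T' :: nat pair_pre_digraph).
     is_tree T \<and> is_tree T' \<and>
     \<not> digraph_iso (with_proj T) (with_proj T') \<and>
     matching_number T = 5 \<and> matching_number T' = 5 \<and>
     Spec T = Spec T' \<and>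
     (\<forall>k. total_walks k T = total_walks k T') \<and>
     generalized_spectrum T = generalized_spectrum T'"
proof -
  \<comment> \<open>The same facts about \<open>Q\<close> feed all three transfer results: spectrum,
    complement spectrum and walk counts.\<close>
  define Q where "Q = mat (11 + m) (11 + m) (\<lambda>(i, j). mix i j)"
  let ?T = "broom m 3" and ?T' = "broom m 7"
  have cards: "card (pverts ?T) = 11 + m" "card (pverts ?T') = 11 + m" by simp_all
  have Q: "Q \<in> carrier_mat (11 + m) (11 + m)" by (simp add: Q_def)
  have sym: "transpose_mat Q = Q" by (intro eq_matI) (simp_all add: Q_def mix_sym)
  have invol: "Q * Q = 1\<^sub>m (11 + m)"
    by (intro eq_matI) (simp_all add: Q_def scalar_prod_def mix_involution)
  have Q_ones: "Q *\<^sub>v ones (11 + m) = ones (11 + m)"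
    by (intro eq_vecI) (simp_all add: Q_def ones_def scalar_prod_def mix_row_sum)
  note intertwine = broom_intertwine[of m, folded Q_def]
  have "Spec ?T = Spec ?T'"
    by (rule Spec_eq_of_intertwine[OF cards Q sym invol Q_ones intertwine])
  moreover have "Spec (complement_graph ?T) = Spec (complement_graph ?T')"
    by (rule Spec_complement_eq_of_intertwine[OF cards Q sym invol Q_ones intertwine])
      (simp_all add: no_loop_broom)
  moreover have "total_walks k ?T = total_walks k ?T'" for k
    by (rule total_walks_eq_of_intertwine[OF cards Q sym invol Q_ones intertwine])
  ultimately show ?thesis
    using broom_not_iso[OF assms]
    by (intro exI[of _ ?T] exI[of _ ?T'])
      (simp add: is_tree_broom matching_number_broom generalized_spectrum_def)
qed

end
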